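(* (i) $\mathbf{B_F}$ is semi-complete with respect to the class of all serial and transitive EGL-models: for every formula $\varphi$, if $\varphi$ is true in every serial and transitive model, then $\vdash_{\mathbf{B_F}}\neg\neg\varphi$. (ii) $\mathbf{T_F}$ is semi-complete with respect to the class of all serial, transitive and reflexive EGL-models: for every formula $\varphi$, if $\varphi$ is true in every serial, transitive and reflexive model, then $\vdash_{\mathbf{T_F}}\neg\neg\varphi$.
   Context: Fix a set $\mathcal P$ of atomic propositions and a set $\mathcal A$ of agents. Formulas: $\varphi ::= p \mid \bot \mid \varphi\wedge\varphi \mid \varphi\to\varphi \mid B_a\varphi$ with $p\in\mathcal P$, $a\in\mathcal A$; $\neg\varphi=\varphi\to\bot$. An EGL-model (model) is $M=(S,(r_a)_{a\in\mathcal A},\pi)$ where $S$ is a non-empty countable set, each $r_a:S\times S\to[0,1]$, and $\pi:S\times\mathcal P\to[0,1]$. Values: $V_s(p)=\pi(s,p)$; $V_s(\bot)=0$; $V_s(\varphi\wedge\psi)=\min\{V_s(\varphi),V_s(\psi)\}$; $V_s(\varphi\to\psi)=1$ if $V_s(\varphi)\le V_s(\psi)$ and $=V_s(\psi)$ otherwise; $V_s(B_a\varphi)=\inf_{s'\in S}\max\{1-r_a(s,s'),V_{s'}(\varphi)\}$. $\varphi$ is true in $M$ if $V_s(\varphi)=1$ for all $s\in S$; $\varphi$ is valid if true in all models. $M$ is serial if for all $a,s$ there is $s'$ with $r_a(s,s')=1$; reflexive if $r_a(s,s)=1$ for all $a,s$; transitive if $r_a(s,s'')\ge\min\{r_a(s,s'),r_a(s',s'')\}$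 for all $a,s,s',s''$. Axioms and rules: (A) all instances of tautologies of propositional Gödel logic; (K) $B_a(\varphi\to\psi)\to(B_a\varphi\to B_a\psi)$; (D) $\neg B_a\bot$; (4) $B_a\varphi\to B_aB_a\varphi$; (T) $B_a\varphi\to\varphi$; (R1) modus ponens; (R2) from $\varphi$ infer $B_a\varphi$. $\mathbf{K_F}$ = (A),(K),(R1),(R2); $\mathbf{B_F}$ = $\mathbf{K_F}$ + (D),(4); $\mathbf{T_F}$ = $\mathbf{B_F}$ + (T). $\vdash_{\mathbf A}\varphi$ means there is a finite sequence of formulas ending in $\varphi$ each of which is an axiom of $\mathbf A$ or is obtained from earlier ones by (R1) or (R2), with the restriction that (R2) cannot be applied to non-valid formulas.
   Formalization: The restriction on (R2) is read with "valid" meaning true in all models of the class in question (serial, transitive; plus reflexive for T_F), not in all EGL-models; under the literal reading the claim fails, e.g. for B_a¬B_a⊥. *)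

theory Defs
  imports Complex_Main "HOL-Library.Countable_Set"
begin

section \<open>Formulas\<close>

datatype ('p, 'a) fm =
    Atom 'p
  | Bot
  | Con "('p, 'a) fm" "('p, 'a) fm"
  | Imp "('p, 'a) fm" "('p, 'a) fm"
  | Bel 'a "('p, 'a) fm"

abbreviation Neg :: "('p, 'a) fm \<Rightarrow> ('p, 'a) fm" where
  "Neg \<phi> \<equiv> Imp \<phi> Bot"


section \<open>EGL-models\<close>

record ('w, 'p, 'a) egl =
  worlds :: "'w set"
  acc :: "'a \<Rightarrow> 'w \<Rightarrow> 'w \<Rightarrow> real"
  val :: "'w \<Rightarrow> 'p \<Rightarrow> real"

definition egl_model :: "('w, 'p, 'a) egl \<Rightarrow> bool" where
  "egl_model M \<longleftrightarrow>
     worlds M \<noteq> {} \<and> countable (worlds M) \<and>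
     (\<forall>a. \<forall>s\<in>worlds M. \<forall>s'\<in>worlds M. acc M a s s' \<in> {0..1}) \<and>
     (\<forall>s\<in>worlds M. \<forall>p. val M s p \<in> {0..1})"

definition goedel_imp :: "real \<Rightarrow> real \<Rightarrow> real" where
  "goedel_imp x y = (if x \<le> y then 1 else y)"

primrec eval_fm :: "('w, 'p, 'a) egl \<Rightarrow> ('p, 'a) fm \<Rightarrow> 'w \<Rightarrow> real" where
  "eval_fm M (Atom p) s = val M s p"
| "eval_fm M Bot s = 0"
| "eval_fm M (Con \<phi> \<psi>) s = min (eval_fm M \<phi> s) (eval_fm M \<psi> s)"
| "eval_fm M (Imp \<phi> \<psi>) s = goedel_imp (eval_fm M \<phi> s) (eval_fm M \<psi> s)"
| "eval_fm M (Bel a \<phi>) s = (INF s'\<in>worlds M. max (1 - acc M a s s') (eval_fm M \<phi> s'))"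

definition true_in :: "('w, 'p, 'a) egl \<Rightarrow> ('p, 'a) fm \<Rightarrow> bool" where
  "true_in M \<phi> \<longleftrightarrow> (\<forall>s\<in>worlds M. eval_fm M \<phi> s = 1)"

definition serial :: "('w, 'p, 'a) egl \<Rightarrow> bool" where
  "serial M \<longleftrightarrow> (\<forall>a. \<forall>s\<in>worlds M. \<exists>s'\<in>worlds M. acc M a s s' = 1)"

definition reflexive :: "('w, 'p, 'a) egl \<Rightarrow> bool" where
  "reflexive M \<longleftrightarrow> (\<forall>a. \<forall>s\<in>worlds M. acc M a s s = 1)"

definition transitive :: "('w, 'p, 'a) egl \<Rightarrow> bool" where
  "transitive M \<longleftrightarrow>
     (\<forall>a. \<forall>s\<in>worlds M. \<forall>s'\<in>worlds M. \<forall>s''\<in>worlds M.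
        acc M a s s'' \<ge> min (acc M a s s') (acc M a s' s''))"

text \<open>
  Quantification over all models must fix a type of worlds. Since the set of worlds is
  countable, models whose worlds are natural numbers represent all models up to isomorphism;
  see \<open>valid_in_imp_true_in\<close> below.
\<close>

type_synonym ('p, 'a) model = "(nat, 'p, 'a) egl"

definition serial_transitive :: "('p, 'a) model set" where
  "serial_transitive = {M. egl_model M \<and> serial M \<and> transitive M}"

definition serial_transitive_reflexive :: "('p, 'a) model set" where
  "serial_transitive_reflexive = {M. egl_model M \<and> serial M \<and> transitive M \<and> reflexive M}"

definition valid_in :: "('p, 'a) model set \<Rightarrow> ('p, 'a) fm \<Rightarrow> bool" where
  "valid_in C \<phi> \<longleftrightarrow> (\<forall>M\<in>C. true_in M \<phi>)"

definition nat_copy :: "('w, 'p, 'a) egl \<Rightarrow> ('p, 'a) model" where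
  "nat_copy M =
     \<lparr>worlds = to_nat_on (worlds M) ` worlds M,
      acc = (\<lambda>a m n. acc M a (from_nat_into (worlds M) m) (from_nat_into (worlds M) n)),
      val = (\<lambda>m. val M (from_nat_into (worlds M) m))\<rparr>"

lemma eval_nat_copy:
  assumes "countable (worlds M)" and "s \<in> worlds M"
  shows "eval_fm (nat_copy M) \<phi> (to_nat_on (worlds M) s) = eval_fm M \<phi> s"
  using assms(2)
proof (induction \<phi> arbitrary: s)
  case (Bel a \<phi>)
  have "eval_fm (nat_copy M) (Bel a \<phi>) (to_nat_on (worlds M) s) =
      (INF s'\<in>worlds M. max (1 - acc M a s s')
        (eval_fm (nat_copy M) \<phi> (to_nat_on (worlds M) s')))"
    using assms(1) Bel.prems by (simp add: nat_copy_def image_image cong: image_cong)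
  then show ?case
    using Bel.IH by (simp cong: image_cong)
qed (use assms(1) in \<open>simp_all add: nat_copy_def\<close>)

lemma true_in_nat_copy:
  "countable (worlds M) \<Longrightarrow> true_in (nat_copy M) \<phi> \<longleftrightarrow> true_in M \<phi>"
  using eval_nat_copy[of M] unfolding true_in_def by (simp add: nat_copy_def)

lemma nat_copy_properties:
  assumes "egl_model M"
  shows "egl_model (nat_copy M)"
    and "serial M \<Longrightarrow> serial (nat_copy M)"
    and "transitive M \<Longrightarrow> transitive (nat_copy M)"
    and "reflexive M \<Longrightarrow> reflexive (nat_copy M)"
  using assms
  unfolding egl_model_def serial_def transitive_def reflexive_def nat_copy_def by auto

lemma valid_in_imp_true_in:
  fixes M :: "('w, 'p, 'a) egl"
  assumes "egl_model M" and "serial M" and "transitive M"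
  shows "valid_in serial_transitive \<phi> \<Longrightarrow> true_in M \<phi>"
    and "valid_in serial_transitive_reflexive \<phi> \<Longrightarrow> reflexive M \<Longrightarrow> true_in M \<phi>"
proof -
  have c: "countable (worlds M)"
    using assms(1) by (simp add: egl_model_def)
  note p = nat_copy_properties[OF assms(1)]
  show "true_in M \<phi>" if "valid_in serial_transitive \<phi>"
    using that p assms true_in_nat_copy[OF c] by (auto simp: valid_in_def serial_transitive_def)
  show "true_in M \<phi>" if "valid_in serial_transitive_reflexive \<phi>" "reflexive M"
    using that p assms true_in_nat_copy[OF c]
    by (auto simp: valid_in_def serial_transitive_reflexive_def)
qed


section \<open>Instances of tautologies of propositional Goedel logic\<close>

datatype pfm = PVar nat | PBot | PCon pfm pfm | PImp pfm pfm

primrec eval_pfm :: "(nat \<Rightarrow> real) \<Rightarrow> pfm \<Rightarrow> real" where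
  "eval_pfm v (PVar i) = v i"
| "eval_pfm v PBot = 0"
| "eval_pfm v (PCon \<alpha> \<beta>) = min (eval_pfm v \<alpha>) (eval_pfm v \<beta>)"
| "eval_pfm v (PImp \<alpha> \<beta>) = goedel_imp (eval_pfm v \<alpha>) (eval_pfm v \<beta>)"

definition goedel_tautology :: "pfm \<Rightarrow> bool" where
  "goedel_tautology \<alpha> \<longleftrightarrow> (\<forall>v. (\<forall>i. v i \<in> {0..1}) \<longrightarrow> eval_pfm v \<alpha> = 1)"

primrec inst :: "(nat \<Rightarrow> ('p, 'a) fm) \<Rightarrow> pfm \<Rightarrow> ('p, 'a) fm" where
  "inst \<sigma> (PVar i) = \<sigma> i"
| "inst \<sigma> PBot = Bot"
| "inst \<sigma> (PCon \<alpha> \<beta>) = Con (inst \<sigma> \<alpha>) (inst \<sigma> \<beta>)"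
| "inst \<sigma> (PImp \<alpha> \<beta>) = Imp (inst \<sigma> \<alpha>) (inst \<sigma> \<beta>)"


section \<open>Axioms and derivations\<close>

definition axA :: "('p, 'a) fm set" where
  "axA = {inst \<sigma> \<alpha> | \<sigma> \<alpha>. goedel_tautology \<alpha>}"

definition axK :: "('p, 'a) fm set" where
  "axK = {Imp (Bel a (Imp \<phi> \<psi>)) (Imp (Bel a \<phi>) (Bel a \<psi>)) | a \<phi> \<psi>. True}"

definition axD :: "('p, 'a) fm set" where
  "axD = {Neg (Bel a Bot) | a. True}"

definition ax4 :: "('p, 'a) fm set" where
  "ax4 = {Imp (Bel a \<phi>) (Bel a (Bel a \<phi>)) | a \<phi>. True}"

definition axT :: "('p, 'a) fm set" where
  "axT = {Imp (Bel a \<phi>) \<phi> | a \<phi>. True}"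

definition KF_axioms :: "('p, 'a) fm set" where
  "KF_axioms = axA \<union> axK"

definition BF_axioms :: "('p, 'a) fm set" where
  "BF_axioms = KF_axioms \<union> axD \<union> ax4"

definition TF_axioms :: "('p, 'a) fm set" where
  "TF_axioms = BF_axioms \<union> axT"

text \<open>
  Rule (R2) may be applied only to valid formulas. Validity is taken relative to the class
  \<open>C\<close> of models of the logic at hand. It cannot mean truth in all EGL-models whatsoever:
  the instances of (D), (4) and (T) are not true in all of them, so (R2) would not apply to
  these axioms and, for example, the double negation of \<open>Bel a (Neg (Bel a Bot))\<close> would be
  underivable although the formula holds in all serial models.
\<close>

definition derivation ::
  "('p, 'a) fm set \<Rightarrow> ('p, 'a) model set \<Rightarrow> ('p, 'a) fm list \<Rightarrow> bool" where
  "derivation Ax C \<chi> \<longleftrightarrow>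
     (\<forall>i<length \<chi>.
        \<chi> ! i \<in> Ax \<or>
        (\<exists>j<i. \<exists>k<i. \<chi> ! k = Imp (\<chi> ! j) (\<chi> ! i)) \<or>
        (\<exists>j<i. \<exists>a. \<chi> ! i = Bel a (\<chi> ! j) \<and> valid_in C (\<chi> ! j)))"

definition derivable ::
  "('p, 'a) fm set \<Rightarrow> ('p, 'a) model set \<Rightarrow> ('p, 'a) fm \<Rightarrow> bool" where
  "derivable Ax C \<phi> \<longleftrightarrow> (\<exists>\<chi>. \<chi> \<noteq> [] \<and> last \<chi> = \<phi> \<and> derivation Ax C \<chi>)"

definition derivable_BF :: "('p, 'a) fm \<Rightarrow> bool" where
  "derivable_BF \<phi> \<longleftrightarrow> derivable BF_axioms serial_transitive \<phi>"

definition derivable_TF :: "('p, 'a) fm \<Rightarrow> bool" where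
  "derivable_TF \<phi> \<longleftrightarrow> derivable TF_axioms serial_transitive_reflexive \<phi>"

definition semi_complete ::
  "(('p, 'a) fm \<Rightarrow> bool) \<Rightarrow> ('p, 'a) model set \<Rightarrow> bool" where
  "semi_complete provable C \<longleftrightarrow> (\<forall>\<phi>. valid_in C \<phi> \<longrightarrow> provable (Neg (Neg \<phi>)))"

end

theory Submission
  imports Defs
begin

text \<open>
  Both logics are in fact complete: every valid formula is derivable, so its double negation is
  too. The worlds of the canonical model are Goedel valuations \<open>V\<close> of the formulas \<open>B\<^sub>a \<psi>\<close> and
  the atoms that give theorems the value 1, and \<open>1 - r\<^sub>a(V, V')\<close> is the least \<open>c\<close> such that
  \<open>V(B\<^sub>a \<psi>) \<le> max c (V' \<psi>)\<close> for all \<open>\<psi>\<close>. If \<open>V(B\<^sub>a \<phi>) < c\<close>, then the formulas \<open>\<psi>\<close> with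
  \<open>V(B\<^sub>a \<psi>) > c\<close> do not prove \<open>\<phi>\<close>. Hence some prime theory \<open>T\<close> contains them but not
  \<open>\<phi>\<close>, and its Lindenbaum chain embeds into the unit interval with \<open>T\<close> sent to 1 and
  everything else below \<open>c\<close>; this is the world showing that \<open>B\<^sub>a \<phi>\<close> has a value at most \<open>c\<close>
  at \<open>V\<close>. Transitivity, reflexivity and seriality are read off (4), (T) and (D). Only the
  countably many formulas in the symbols of \<open>\<phi>\<close> are valuated, and only countably many witnesses
  are kept. Soundness makes the restriction on (R2) harmless.
\<close>

section \<open>Derivations and soundness\<close>

lemma derivation_append:
  assumes "derivation Ax C \<chi>" and "derivation Ax C \<chi>'"
  shows "derivation Ax C (\<chi> @ \<chi>')"
  unfolding derivation_def
proof (intro allI impI)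
  fix i assume i: "i < length (\<chi> @ \<chi>')"
  let ?xs = "\<chi> @ \<chi>'" and ?n = "length \<chi>"
  show "?xs ! i \<in> Ax \<or> (\<exists>j<i. \<exists>k<i. ?xs ! k = Imp (?xs ! j) (?xs ! i)) \<or>
      (\<exists>j<i. \<exists>a. ?xs ! i = Bel a (?xs ! j) \<and> valid_in C (?xs ! j))"
  proof (cases "i < ?n")
    case True
    then have "\<And>j. j \<le> i \<Longrightarrow> ?xs ! j = \<chi> ! j"
      by (simp add: nth_append)
    then show ?thesis
      using assms(1) True unfolding derivation_def by (metis less_imp_le order_refl)
  next
    case False
    then obtain m where m: "i = ?n + m" "m < length \<chi>'"
      using i by (metis add_less_cancel_left length_append le_Suc_ex not_less)
    have shift: "?xs ! (?n + j) = \<chi>' ! j" for j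
      by simp
    from assms(2) m(2) consider "\<chi>' ! m \<in> Ax"
      | j k where "j < m" "k < m" "\<chi>' ! k = Imp (\<chi>' ! j) (\<chi>' ! m)"
      | j a where "j < m" "\<chi>' ! m = Bel a (\<chi>' ! j)" "valid_in C (\<chi>' ! j)"
      unfolding derivation_def by blast
    then show ?thesis
    proof cases
      case 1
      then show ?thesis by (simp add: m(1))
    next
      case 2
      then have "?n + j < i" "?n + k < i" "?xs ! (?n + k) = Imp (?xs ! (?n + j)) (?xs ! i)"
        using m(1) by simp_all
      then show ?thesis by blast
    next
      case 3
      then have "?n + j < i" "?xs ! i = Bel a (?xs ! (?n + j))" "valid_in C (?xs ! (?n + j))"
        using m(1) by simp_all
      then show ?thesis by blast
    qed
  qed
qed

lemma derivation_snoc: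
  assumes "derivation Ax C \<chi>"
    and "\<phi> \<in> Ax \<or> (\<exists>\<alpha>\<in>set \<chi>. Imp \<alpha> \<phi> \<in> set \<chi>) \<or>
      (\<exists>\<alpha>\<in>set \<chi>. \<exists>a. \<phi> = Bel a \<alpha> \<and> valid_in C \<alpha>)"
  shows "derivation Ax C (\<chi> @ [\<phi>])"
  unfolding derivation_def
proof (intro allI impI)
  fix i assume i: "i < length (\<chi> @ [\<phi>])"
  let ?xs = "\<chi> @ [\<phi>]"
  show "?xs ! i \<in> Ax \<or> (\<exists>j<i. \<exists>k<i. ?xs ! k = Imp (?xs ! j) (?xs ! i)) \<or>
      (\<exists>j<i. \<exists>a. ?xs ! i = Bel a (?xs ! j) \<and> valid_in C (?xs ! j))"
  proof (cases "i < length \<chi>")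
    case True
    then have "\<And>j. j \<le> i \<Longrightarrow> ?xs ! j = \<chi> ! j"
      by (simp add: nth_append)
    then show ?thesis
      using assms(1) True unfolding derivation_def by (metis less_imp_le order_refl)
  next
    case False
    then have [simp]: "i = length \<chi>"
      using i by simp
    have "\<exists>j<i. ?xs ! j = \<alpha>" if "\<alpha> \<in> set \<chi>" for \<alpha>
      using that by (metis \<open>i = length \<chi>\<close> in_set_conv_nth nth_append)
    then show ?thesis
      using assms(2) by (simp, metis)
  qed
qed

lemma derivable_axiom: "\<phi> \<in> Ax \<Longrightarrow> derivable Ax C \<phi>"
  unfolding derivable_def
  by (rule exI[of _ "[\<phi>]"]) (simp add: derivation_def)

lemma derivable_MP:
  assumes "derivable Ax C (Imp \<phi> \<psi>)" and "derivable Ax C \<phi>"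
  shows "derivable Ax C \<psi>"
proof -
  obtain \<chi> \<chi>' where d: "derivation Ax C \<chi>" "derivation Ax C \<chi>'"
    and ne: "\<chi> \<noteq> []" "last \<chi> = Imp \<phi> \<psi>" "\<chi>' \<noteq> []" "last \<chi>' = \<phi>"
    using assms by (auto simp: derivable_def)
  then have "\<phi> \<in> set (\<chi> @ \<chi>')" "Imp \<phi> \<psi> \<in> set (\<chi> @ \<chi>')"
    using last_in_set by fastforce+
  then have "derivation Ax C ((\<chi> @ \<chi>') @ [\<psi>])"
    by (intro derivation_snoc derivation_append d) blast
  then show ?thesis
    unfolding derivable_def by (metis last_snoc snoc_eq_iff_butlast)
qed

lemma derivable_Bel:
  assumes "derivable Ax C \<phi>" and "valid_in C \<phi>"
  shows "derivable Ax C (Bel a \<phi>)"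
proof -
  obtain \<chi> where d: "derivation Ax C \<chi>" and "\<chi> \<noteq> []" "last \<chi> = \<phi>"
    using assms by (auto simp: derivable_def)
  then have "\<phi> \<in> set \<chi>"
    using last_in_set by blast
  then have "derivation Ax C (\<chi> @ [Bel a \<phi>])"
    using assms(2) by (intro derivation_snoc d) blast
  then show ?thesis
    unfolding derivable_def by (metis last_snoc snoc_eq_iff_butlast)
qed

lemma derivable_induct [consumes 1, case_names axiom MP Bel]:
  assumes "derivable Ax C \<phi>"
    and ax: "\<And>\<phi>. \<phi> \<in> Ax \<Longrightarrow> P \<phi>"
    and mp: "\<And>\<phi> \<psi>. P (Imp \<phi> \<psi>) \<Longrightarrow> P \<phi> \<Longrightarrow> P \<psi>"
    and bel: "\<And>a \<phi>. P \<phi> \<Longrightarrow> P (Bel a \<phi>)"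
  shows "P \<phi>"
proof -
  obtain \<chi> where d: "derivation Ax C \<chi>" and ne: "\<chi> \<noteq> []" and l: "last \<chi> = \<phi>"
    using assms(1) by (auto simp: derivable_def)
  have "P (\<chi> ! i)" if "i < length \<chi>" for i
    using that
  proof (induction i rule: less_induct)
    case (less i)
    then have IH: "P (\<chi> ! j)" if "j < i" for j
      using that by simp
    from d less.prems consider "\<chi> ! i \<in> Ax"
      | j k where "j < i" "k < i" "\<chi> ! k = Imp (\<chi> ! j) (\<chi> ! i)"
      | j a where "j < i" "\<chi> ! i = Bel a (\<chi> ! j)"
      unfolding derivation_def by blast
    then show ?case
      by cases (use ax mp bel IH in metis)+
  qed
  then show ?thesis
    using ne l by (metis diff_less last_conv_nth length_greater_0_conv zero_less_one)
qed

lemma le_goedel_imp_iff: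
  "x \<le> 1 \<Longrightarrow> x \<le> goedel_imp y z \<longleftrightarrow> min x y \<le> z"
  by (auto simp: goedel_imp_def min_def)

lemma goedel_imp_eq_1_iff:
  "x \<le> 1 \<Longrightarrow> goedel_imp x y = 1 \<longleftrightarrow> x \<le> y"
  by (auto simp: goedel_imp_def)

lemma eval_fm_range:
  assumes "egl_model M" and "s \<in> worlds M"
  shows "eval_fm M \<phi> s \<in> {0..1}"
  using assms(2)
proof (induction \<phi> arbitrary: s)
  case (Atom p)
  then show ?case using assms(1) by (simp add: egl_model_def)
next
  case (Con \<phi> \<psi>)
  then show ?case by (fastforce simp: min_def)
next
  case (Imp \<phi> \<psi>)
  then show ?case by (fastforce simp: goedel_imp_def)
next
  case (Bel a \<phi>)
  have acc: "acc M a s s' \<in> {0..1}" if "s' \<in> worlds M" for s'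
    using assms(1) that Bel.prems by (simp add: egl_model_def)
  let ?f = "\<lambda>s'. max (1 - acc M a s s') (eval_fm M \<phi> s')"
  have f: "0 \<le> ?f s' \<and> ?f s' \<le> 1" if "s' \<in> worlds M" for s'
    using acc[OF that] Bel.IH[OF that] by auto
  have "(INF s'\<in>worlds M. ?f s') \<le> ?f s"
    using Bel.prems f by (intro cINF_lower bdd_belowI2[of _ 0]) auto
  moreover have "0 \<le> (INF s'\<in>worlds M. ?f s')"
    using Bel.prems f by (intro cINF_greatest) auto
  ultimately show ?case
    using f[OF Bel.prems] unfolding eval_fm.simps atLeastAtMost_iff by linarith
qed simp

lemma eval_Bel_le:
  assumes "egl_model M" and "s' \<in> worlds M"
  shows "eval_fm M (Bel a \<phi>) s \<le> max (1 - acc M a s s') (eval_fm M \<phi> s')"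
  unfolding eval_fm.simps
proof (rule cINF_lower[OF _ assms(2)])
  show "bdd_below ((\<lambda>s'. max (1 - acc M a s s') (eval_fm M \<phi> s')) ` worlds M)"
    using eval_fm_range[OF assms(1), of _ \<phi>]
    by (intro bdd_belowI2[of _ 0]) (simp add: le_max_iff_disj)
qed

lemma le_eval_Bel:
  assumes "worlds M \<noteq> {}"
    and "\<And>s'. s' \<in> worlds M \<Longrightarrow> c \<le> max (1 - acc M a s s') (eval_fm M \<phi> s')"
  shows "c \<le> eval_fm M (Bel a \<phi>) s"
  using assms by (simp add: cINF_greatest)

lemma eval_inst:
  "eval_fm M (inst \<sigma> \<alpha>) s = eval_pfm (\<lambda>i. eval_fm M (\<sigma> i) s) \<alpha>"
  by (induction \<alpha>) auto

lemma true_in_ImpI: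
  assumes "egl_model M"
    and "\<And>s. s \<in> worlds M \<Longrightarrow> eval_fm M \<phi> s \<le> eval_fm M \<psi> s"
  shows "true_in M (Imp \<phi> \<psi>)"
  using assms by (simp add: true_in_def goedel_imp_def)

lemma axA_true_in: "egl_model M \<Longrightarrow> \<phi> \<in> axA \<Longrightarrow> true_in M \<phi>"
  using eval_fm_range[of M]
  by (auto simp: axA_def true_in_def eval_inst goedel_tautology_def)

lemma axK_true_in:
  assumes M: "egl_model M" and "\<phi> \<in> axK"
  shows "true_in M \<phi>"
proof -
  obtain a \<alpha> \<beta> where \<phi>: "\<phi> = Imp (Bel a (Imp \<alpha> \<beta>)) (Imp (Bel a \<alpha>) (Bel a \<beta>))"
    using assms(2) by (auto simp: axK_def)
  have "eval_fm M (Bel a (Imp \<alpha> \<beta>)) s \<le> eval_fm M (Imp (Bel a \<alpha>) (Bel a \<beta>)) s"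
    if s: "s \<in> worlds M" for s
  proof -
    have "min (eval_fm M (Bel a (Imp \<alpha> \<beta>)) s) (eval_fm M (Bel a \<alpha>) s) \<le> eval_fm M (Bel a \<beta>) s"
    proof (rule le_eval_Bel)
      fix s' assume s': "s' \<in> worlds M"
      have "min (goedel_imp x y) x \<le> y" for x y :: real
        by (simp add: goedel_imp_def min_def)
      then show "min (eval_fm M (Bel a (Imp \<alpha> \<beta>)) s) (eval_fm M (Bel a \<alpha>) s)
          \<le> max (1 - acc M a s s') (eval_fm M \<beta> s')"
        using eval_Bel_le[OF M s', of a "Imp \<alpha> \<beta>" s] eval_Bel_le[OF M s', of a \<alpha> s]
        by (simp del: eval_fm.simps(5)) (smt (verit, best) max_def min_def)
    qed (use s in auto)
    then show ?thesis
      using eval_fm_range[OF M s, of "Bel a (Imp \<alpha> \<beta>)"]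
      by (simp del: eval_fm.simps(5) add: le_goedel_imp_iff)
  qed
  then show ?thesis
    unfolding \<phi> by (rule true_in_ImpI[OF M])
qed

lemma axD_true_in:
  assumes M: "egl_model M" and "serial M" and "\<phi> \<in> axD"
  shows "true_in M \<phi>"
proof -
  obtain a where \<phi>: "\<phi> = Neg (Bel a Bot)"
    using assms(3) by (auto simp: axD_def)
  have "eval_fm M (Bel a Bot) s \<le> eval_fm M Bot s" if s: "s \<in> worlds M" for s
  proof -
    obtain s' where "s' \<in> worlds M" "acc M a s s' = 1"
      using assms(2) s by (auto simp: serial_def)
    then show ?thesis
      using eval_Bel_le[OF M, of s' a Bot s] by (simp del: eval_fm.simps(5))
  qed
  then show ?thesis
    unfolding \<phi> by (rule true_in_ImpI[OF M])
qed

lemma ax4_true_in: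
  assumes M: "egl_model M" and "transitive M" and "\<phi> \<in> ax4"
  shows "true_in M \<phi>"
proof -
  obtain a \<alpha> where \<phi>: "\<phi> = Imp (Bel a \<alpha>) (Bel a (Bel a \<alpha>))"
    using assms(3) by (auto simp: ax4_def)
  have "eval_fm M (Bel a \<alpha>) s \<le> eval_fm M (Bel a (Bel a \<alpha>)) s" if s: "s \<in> worlds M" for s
  proof (rule le_eval_Bel)
    fix s' assume s': "s' \<in> worlds M"
    show "eval_fm M (Bel a \<alpha>) s \<le> max (1 - acc M a s s') (eval_fm M (Bel a \<alpha>) s')"
    proof (rule ccontr)
      assume "\<not> ?thesis"
      then have less: "1 - acc M a s s' < eval_fm M (Bel a \<alpha>) s"
        "eval_fm M (Bel a \<alpha>) s' < eval_fm M (Bel a \<alpha>) s"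
        by (auto simp del: eval_fm.simps(5))
      have "eval_fm M (Bel a \<alpha>) s \<le> eval_fm M (Bel a \<alpha>) s'"
      proof (rule le_eval_Bel)
        fix s'' assume s'': "s'' \<in> worlds M"
        have "min (acc M a s s') (acc M a s' s'') \<le> acc M a s s''"
          using assms(2) s s' s'' by (simp add: transitive_def)
        then show "eval_fm M (Bel a \<alpha>) s \<le> max (1 - acc M a s' s'') (eval_fm M \<alpha> s'')"
          using eval_Bel_le[OF M s'', of a \<alpha> s] less(1) by linarith
      qed (use s in auto)
      then show False
        using less(2) by simp
    qed
  qed (use s in auto)
  then show ?thesis
    unfolding \<phi> by (rule true_in_ImpI[OF M])
qed

lemma axT_true_in:
  assumes M: "egl_model M" and "reflexive M" and "\<phi> \<in> axT"
  shows "true_in M \<phi>"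
proof -
  obtain a \<alpha> where \<phi>: "\<phi> = Imp (Bel a \<alpha>) \<alpha>"
    using assms(3) by (auto simp: axT_def)
  have "eval_fm M (Bel a \<alpha>) s \<le> eval_fm M \<alpha> s" if s: "s \<in> worlds M" for s
    using eval_Bel_le[OF M s, of a \<alpha> s] assms(2) s eval_fm_range[OF M s, of \<alpha>]
    by (simp del: eval_fm.simps(5) add: reflexive_def)
  then show ?thesis
    unfolding \<phi> by (rule true_in_ImpI[OF M])
qed


section \<open>Prime theories\<close>

locale normal_logic =
  fixes Ax :: "('p, 'a) fm set" and C :: "('p, 'a) model set"
  assumes KF_axioms_subset: "KF_axioms \<subseteq> Ax"
    and axioms_valid: "\<phi> \<in> Ax \<Longrightarrow> valid_in C \<phi>"
    and egl_models: "M \<in> C \<Longrightarrow> egl_model M"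
begin

abbreviation prv :: "('p, 'a) fm \<Rightarrow> bool" where
  "prv \<equiv> derivable Ax C"

lemma prv_valid: "prv \<phi> \<Longrightarrow> valid_in C \<phi>"
proof (induction \<phi> rule: derivable_induct)
  case (axiom \<phi>)
  then show ?case by (rule axioms_valid)
next
  case (MP \<phi> \<psi>)
  show ?case
    unfolding valid_in_def true_in_def
  proof (intro ballI)
    fix M s assume M: "M \<in> C" and s: "s \<in> worlds M"
    then have "eval_fm M (Imp \<phi> \<psi>) s = 1" "eval_fm M \<phi> s = 1"
      using MP by (auto simp: valid_in_def true_in_def)
    then show "eval_fm M \<psi> s = 1"
      using eval_fm_range[OF egl_models[OF M] s, of \<psi>] by (simp add: goedel_imp_def split: if_splits)
  qed
next
  case (Bel a \<phi>)
  show ?case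
    unfolding valid_in_def true_in_def
  proof (intro ballI)
    fix M s assume M: "M \<in> C" and s: "s \<in> worlds M"
    have "1 \<le> eval_fm M (Bel a \<phi>) s"
      using Bel M s by (intro le_eval_Bel) (auto simp: valid_in_def true_in_def)
    then show "eval_fm M (Bel a \<phi>) s = 1"
      using eval_fm_range[OF egl_models[OF M] s, of "Bel a \<phi>"] by simp
  qed
qed

lemma prv_necessitation: "prv \<phi> \<Longrightarrow> prv (Bel a \<phi>)"
  by (simp add: derivable_Bel prv_valid)

lemma prv_inst: "goedel_tautology \<alpha> \<Longrightarrow> prv (inst \<sigma> \<alpha>)"
  using KF_axioms_subset by (intro derivable_axiom) (auto simp: KF_axioms_def axA_def)

lemma prv_K: "prv (Imp (Bel a (Imp \<phi> \<psi>)) (Imp (Bel a \<phi>) (Bel a \<psi>)))"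
  using KF_axioms_subset by (intro derivable_axiom) (auto simp: KF_axioms_def axK_def)

lemma prv_weakening: "prv (Imp \<phi> (Imp \<psi> \<phi>))"
  using prv_inst[of "PImp (PVar 0) (PImp (PVar 1) (PVar 0))" "\<lambda>i. [\<phi>, \<psi>] ! i"]
  by (simp add: goedel_tautology_def goedel_imp_def)

lemma prv_refl: "prv (Imp \<phi> \<phi>)"
  using prv_inst[of "PImp (PVar 0) (PVar 0)" "\<lambda>i. \<phi>"]
  by (simp add: goedel_tautology_def goedel_imp_def)

lemma prv_distrib: "prv (Imp (Imp \<phi> (Imp \<psi> \<chi>)) (Imp (Imp \<phi> \<psi>) (Imp \<phi> \<chi>)))"
  using prv_inst[of "PImp (PImp (PVar 0) (PImp (PVar 1) (PVar 2)))
      (PImp (PImp (PVar 0) (PVar 1)) (PImp (PVar 0) (PVar 2)))" "\<lambda>i. [\<phi>, \<psi>, \<chi>] ! i"]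
  by (simp add: goedel_tautology_def goedel_imp_def)

lemma prv_Con1: "prv (Imp (Con \<phi> \<psi>) \<phi>)"
  using prv_inst[of "PImp (PCon (PVar 0) (PVar 1)) (PVar 0)" "\<lambda>i. [\<phi>, \<psi>] ! i"]
  by (simp add: goedel_tautology_def goedel_imp_def)

lemma prv_Con2: "prv (Imp (Con \<phi> \<psi>) \<psi>)"
  using prv_inst[of "PImp (PCon (PVar 0) (PVar 1)) (PVar 1)" "\<lambda>i. [\<phi>, \<psi>] ! i"]
  by (simp add: goedel_tautology_def goedel_imp_def)

lemma prv_ConI: "prv (Imp \<phi> (Imp \<psi> (Con \<phi> \<psi>)))"
  using prv_inst[of "PImp (PVar 0) (PImp (PVar 1) (PCon (PVar 0) (PVar 1)))" "\<lambda>i. [\<phi>, \<psi>] ! i"]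
  by (simp add: goedel_tautology_def goedel_imp_def)

lemma prv_ex_falso: "prv (Imp Bot \<phi>)"
  using prv_inst[of "PImp PBot (PVar 0)" "\<lambda>i. \<phi>"]
  by (simp add: goedel_tautology_def goedel_imp_def)

lemma prv_linearity:
  "prv (Imp (Imp (Imp \<phi> \<psi>) \<chi>) (Imp (Imp (Imp \<psi> \<phi>) \<chi>) \<chi>))"
  using prv_inst[of "PImp (PImp (PImp (PVar 0) (PVar 1)) (PVar 2))
      (PImp (PImp (PImp (PVar 1) (PVar 0)) (PVar 2)) (PVar 2))" "\<lambda>i. [\<phi>, \<psi>, \<chi>] ! i"]
  by (simp add: goedel_tautology_def goedel_imp_def)

lemma prv_not_not: "prv (Imp \<phi> (Neg (Neg \<phi>)))"
  using prv_inst[of "PImp (PVar 0) (PImp (PImp (PVar 0) PBot) PBot)" "\<lambda>i. \<phi>"]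
  by (simp add: goedel_tautology_def goedel_imp_def)

definition theory_set :: "('p, 'a) fm set \<Rightarrow> bool" where
  "theory_set T \<longleftrightarrow> {\<chi>. prv \<chi>} \<subseteq> T \<and> (\<forall>\<phi> \<psi>. Imp \<phi> \<psi> \<in> T \<longrightarrow> \<phi> \<in> T \<longrightarrow> \<psi> \<in> T)"

lemma theory_prv: "theory_set T \<Longrightarrow> prv \<phi> \<Longrightarrow> \<phi> \<in> T"
  by (auto simp: theory_set_def)

lemma theory_MP: "theory_set T \<Longrightarrow> Imp \<phi> \<psi> \<in> T \<Longrightarrow> \<phi> \<in> T \<Longrightarrow> \<psi> \<in> T"
  by (auto simp: theory_set_def)

lemma theory_weaken: "theory_set T \<Longrightarrow> \<psi> \<in> T \<Longrightarrow> Imp \<phi> \<psi> \<in> T"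
  using theory_MP theory_prv prv_weakening by blast

lemma theory_distrib:
  "theory_set T \<Longrightarrow> Imp \<phi> (Imp \<psi> \<chi>) \<in> T \<Longrightarrow> Imp \<phi> \<psi> \<in> T \<Longrightarrow> Imp \<phi> \<chi> \<in> T"
  using theory_MP theory_prv prv_distrib by blast

lemma theory_trans:
  "theory_set T \<Longrightarrow> Imp \<phi> \<psi> \<in> T \<Longrightarrow> Imp \<psi> \<chi> \<in> T \<Longrightarrow> Imp \<phi> \<chi> \<in> T"
  using theory_distrib theory_weaken by blast

lemma theory_set_prv: "theory_set {\<chi>. prv \<chi>}"
  by (auto simp: theory_set_def intro: derivable_MP)

lemma theory_set_extend:
  assumes "theory_set T"
  shows "theory_set {\<chi>. Imp \<alpha> \<chi> \<in> T}"
  using assms theory_weaken theory_prv theory_distrib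
  unfolding theory_set_def[of "{\<chi>. Imp \<alpha> \<chi> \<in> T}"] by blast

definition prime_theory :: "('p, 'a) fm set \<Rightarrow> bool" where
  "prime_theory T \<longleftrightarrow> theory_set T \<and> (\<forall>\<alpha> \<beta>. Imp \<alpha> \<beta> \<in> T \<or> Imp \<beta> \<alpha> \<in> T)"

lemma prime_theory_extension:
  assumes "theory_set T\<^sub>0" and "\<phi> \<notin> T\<^sub>0"
  obtains T where "prime_theory T" "T\<^sub>0 \<subseteq> T" "\<phi> \<notin> T"
proof -
  define \<A> where "\<A> = {T. theory_set T \<and> T\<^sub>0 \<subseteq> T \<and> \<phi> \<notin> T}"
  have "\<exists>T\<in>\<A>. \<forall>X\<in>\<A>. T \<subseteq> X \<longrightarrow> X = T"
  proof (rule subset_Zorn_nonempty)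
    show "\<A> \<noteq> {}"
      using assms by (auto simp: \<A>_def)
    fix \<C> assume ne: "\<C> \<noteq> {}" and ch: "subset.chain \<A> \<C>"
    then have sub: "\<C> \<subseteq> \<A>" and tot: "\<And>X Y. X \<in> \<C> \<Longrightarrow> Y \<in> \<C> \<Longrightarrow> X \<subseteq> Y \<or> Y \<subseteq> X"
      by (auto simp: subset_chain_def)
    have th: "\<And>X. X \<in> \<C> \<Longrightarrow> theory_set X" "\<And>X. X \<in> \<C> \<Longrightarrow> T\<^sub>0 \<subseteq> X" "\<And>X. X \<in> \<C> \<Longrightarrow> \<phi> \<notin> X"
      using sub by (auto simp: \<A>_def)
    have "theory_set (\<Union>\<C>)"
      unfolding theory_set_def
    proof (intro conjI allI impI)
      show "{\<chi>. prv \<chi>} \<subseteq> \<Union>\<C>"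
        using ne th(1) theory_prv by blast
      fix \<alpha> \<beta> assume "Imp \<alpha> \<beta> \<in> \<Union>\<C>" "\<alpha> \<in> \<Union>\<C>"
      then obtain X Y where "X \<in> \<C>" "Y \<in> \<C>" "Imp \<alpha> \<beta> \<in> X" "\<alpha> \<in> Y"
        by blast
      then show "\<beta> \<in> \<Union>\<C>"
        using tot[of X Y] th(1) theory_MP by (metis UnionI subsetD)
    qed
    then show "\<Union>\<C> \<in> \<A>"
      using ne th(2,3) by (auto simp: \<A>_def)
  qed
  then obtain T where "T \<in> \<A>" and maximal: "\<And>X. X \<in> \<A> \<Longrightarrow> T \<subseteq> X \<Longrightarrow> X = T"
    by blast
  then have T: "theory_set T" "T\<^sub>0 \<subseteq> T" "\<phi> \<notin> T"
    by (auto simp: \<A>_def)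
  have ext: "Imp \<alpha> \<phi> \<in> T" if "\<alpha> \<notin> T" for \<alpha>
  proof (rule ccontr)
    assume "Imp \<alpha> \<phi> \<notin> T"
    moreover have sub: "T \<subseteq> {\<chi>. Imp \<alpha> \<chi> \<in> T}"
      using T(1) theory_weaken by auto
    ultimately have "{\<chi>. Imp \<alpha> \<chi> \<in> T} \<in> \<A>"
      using T(1,2) theory_set_extend by (auto simp: \<A>_def)
    then have "{\<chi>. Imp \<alpha> \<chi> \<in> T} = T"
      using sub by (rule maximal)
    moreover have "Imp \<alpha> \<alpha> \<in> T"
      using T(1) prv_refl theory_prv by blast
    ultimately show False
      using that by blast
  qed
  have "Imp \<alpha> \<beta> \<in> T \<or> Imp \<beta> \<alpha> \<in> T" for \<alpha> \<beta>
  proof (rule ccontr)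
    assume "\<not> ?thesis"
    then have "Imp (Imp \<alpha> \<beta>) \<phi> \<in> T" "Imp (Imp \<beta> \<alpha>) \<phi> \<in> T"
      using ext by auto
    then have "\<phi> \<in> T"
      using theory_MP[OF T(1)] theory_prv[OF T(1) prv_linearity] by blast
    then show False
      using T(3) by simp
  qed
  then show ?thesis
    using that T unfolding prime_theory_def by blast
qed


section \<open>Goedel valuations of a countable language\<close>

definition goedel_val :: "('p, 'a) fm set \<Rightarrow> (('p, 'a) fm \<Rightarrow> real) \<Rightarrow> bool" where
  "goedel_val L V \<longleftrightarrow> (\<forall>\<phi>\<in>L. V \<phi> \<in> {0..1}) \<and> V Bot = 0 \<and>
     (\<forall>\<phi>\<in>L. \<forall>\<psi>\<in>L. V (Con \<phi> \<psi>) = min (V \<phi>) (V \<psi>)) \<and>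
     (\<forall>\<phi>\<in>L. \<forall>\<psi>\<in>L. V (Imp \<phi> \<psi>) = goedel_imp (V \<phi>) (V \<psi>)) \<and>
     (\<forall>\<phi>\<in>L. prv \<phi> \<longrightarrow> V \<phi> = 1)"

end

lemma suminf_strict_mono:
  fixes f g :: "nat \<Rightarrow> real"
  assumes "summable f" and "summable g" and "\<And>n. f n \<le> g n" and "f i < g i"
  shows "suminf f < suminf g"
proof -
  have "0 < (\<Sum>n. g n - f n)"
    using assms by (intro suminf_pos2[of _ i] summable_diff) auto
  then show ?thesis
    using suminf_diff[OF assms(2,1)] by simp
qed

text \<open>
  The value of \<open>x\<close> is the total weight of the elements strictly below \<open>x\<close>, the \<open>n\<close>-th
  element having weight \<open>2^-(n+1)\<close>.
\<close>

lemma countable_preorder_embedding: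
  fixes le :: "'b \<Rightarrow> 'b \<Rightarrow> bool"
  assumes L: "countable L"
    and refl: "\<And>x. le x x"
    and trans: "\<And>x y z. le x y \<Longrightarrow> le y z \<Longrightarrow> le x z"
    and total: "\<And>x y. le x y \<or> le y x"
  shows "\<exists>f :: 'b \<Rightarrow> real. (\<forall>x\<in>L. 0 \<le> f x \<and> f x < 1) \<and>
    (\<forall>x\<in>L. \<forall>y\<in>L. f x \<le> f y \<longleftrightarrow> le x y) \<and> (\<forall>x. (\<forall>y. le x y) \<longrightarrow> f x = 0)"
proof -
  define w where "w x n = (if \<exists>y\<in>L. to_nat_on L y = n \<and> \<not> le x y then (1 / 2 :: real) ^ Suc n else 0)"
    for x n
  define f where "f x = suminf (w x)" for x
  have sums: "(\<lambda>n. (1 / 2 :: real) ^ Suc n) sums 1"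
    by (rule power_half_series)
  have w: "0 \<le> w x n" "w x n \<le> (1 / 2) ^ Suc n" for x n
    by (auto simp: w_def)
  have summ: "summable (w x)" for x
    using w by (intro summable_comparison_test'[OF sums_summable[OF sums], of 0]) auto
  have mono: "w x n \<le> w y n" if "le x y" for x y n
    using that trans unfolding w_def by auto
  have strict: "f x < f y" if "\<not> le y x" "x \<in> L" for x y
    unfolding f_def
  proof (rule suminf_strict_mono[OF summ summ])
    have "le x y"
      using total that(1) by blast
    then show "w x n \<le> w y n" for n
      by (rule mono)
    have "w x (to_nat_on L x) = 0"
      using that(2) L refl by (auto simp: w_def)
    moreover have "w y (to_nat_on L x) > 0"
      using that by (auto simp: w_def)
    ultimately show "w x (to_nat_on L x) < w y (to_nat_on L x)"
      by simp
  qed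
  show ?thesis
  proof (intro exI[of _ f] conjI ballI allI impI)
    show "0 \<le> f x" for x
      unfolding f_def using w summ by (intro suminf_nonneg) auto
    show "f x < 1" if "x \<in> L" for x
    proof -
      have "w x (to_nat_on L x) = 0"
        using that L refl by (auto simp: w_def)
      then have "w x (to_nat_on L x) < (1 / 2) ^ Suc (to_nat_on L x)"
        by simp
      then have "f x < (\<Sum>n. (1 / 2 :: real) ^ Suc n)"
        unfolding f_def using w by (intro suminf_strict_mono[OF summ sums_summable[OF sums]]) auto
      then show ?thesis
        using sums_unique[OF sums] by simp
    qed
    show "f x \<le> f y \<longleftrightarrow> le x y" if "x \<in> L" "y \<in> L" for x y
    proof
      show "le x y" if "f x \<le> f y"
        using that strict[of x y] strict[of y x] \<open>y \<in> L\<close> by fastforce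
      show "f x \<le> f y" if "le x y"
        unfolding f_def using mono[OF that] summ by (intro suminf_le) auto
    qed
    show "f x = 0" if "\<forall>y. le x y" for x
      using that by (simp add: f_def w_def[abs_def])
  qed
qed

context normal_logic
begin

lemma goedel_val_of_prime_theory:
  assumes L: "countable L" and closed: "Bot \<in> L"
      "\<And>\<phi> \<psi>. \<phi> \<in> L \<Longrightarrow> \<psi> \<in> L \<Longrightarrow> Con \<phi> \<psi> \<in> L" "\<And>\<phi> \<psi>. \<phi> \<in> L \<Longrightarrow> \<psi> \<in> L \<Longrightarrow> Imp \<phi> \<psi> \<in> L"
    and T: "prime_theory T" and Bot: "Bot \<notin> T" and c: "0 < c" "c < 1"
  obtains V where "goedel_val L V" "\<And>\<phi>. \<phi> \<in> T \<Longrightarrow> V \<phi> = 1" "\<And>\<phi>. \<phi> \<in> L \<Longrightarrow> \<phi> \<notin> T \<Longrightarrow> V \<phi> \<le> c"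
proof -
  define le where "le \<alpha> \<beta> \<longleftrightarrow> Imp \<alpha> \<beta> \<in> T" for \<alpha> \<beta>
  have th: "theory_set T" and total: "\<And>\<alpha> \<beta>. le \<alpha> \<beta> \<or> le \<beta> \<alpha>"
    using T by (auto simp: prime_theory_def le_def)
  have refl: "le \<alpha> \<alpha>" for \<alpha>
    using th prv_refl theory_prv by (auto simp: le_def)
  have trans: "le \<alpha> \<gamma>" if "le \<alpha> \<beta>" "le \<beta> \<gamma>" for \<alpha> \<beta> \<gamma>
    using that th theory_trans by (auto simp: le_def)
  have "\<exists>f :: ('p, 'a) fm \<Rightarrow> real. (\<forall>x\<in>L. 0 \<le> f x \<and> f x < 1) \<and>
      (\<forall>x\<in>L. \<forall>y\<in>L. f x \<le> f y \<longleftrightarrow> le x y) \<and> (\<forall>x. (\<forall>y. le x y) \<longrightarrow> f x = 0)"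
    using L refl trans total by (rule countable_preorder_embedding)
  then obtain f :: "('p, 'a) fm \<Rightarrow> real" where
    f: "(\<forall>x\<in>L. 0 \<le> f x \<and> f x < 1) \<and> (\<forall>x\<in>L. \<forall>y\<in>L. f x \<le> f y \<longleftrightarrow> le x y) \<and>
      (\<forall>x. (\<forall>y. le x y) \<longrightarrow> f x = 0)" ..
  then have f0: "\<And>x. x \<in> L \<Longrightarrow> 0 \<le> f x" and f1: "\<And>x. x \<in> L \<Longrightarrow> f x < 1"
    and fle: "\<And>x y. x \<in> L \<Longrightarrow> y \<in> L \<Longrightarrow> f x \<le> f y \<longleftrightarrow> le x y"
    and fbot: "\<And>x. \<forall>y. le x y \<Longrightarrow> f x = 0"
    by auto
  define V where "V \<alpha> = (if \<alpha> \<in> T then 1 else c * f \<alpha>)" for \<alpha>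
  have Vle: "V \<alpha> \<le> c" if "\<alpha> \<in> L" "\<alpha> \<notin> T" for \<alpha>
    using that f1[of \<alpha>] c by (simp add: V_def mult_left_le)
  have V01: "0 \<le> V \<alpha>" "V \<alpha> \<le> 1" if "\<alpha> \<in> L" for \<alpha>
  proof -
    show "0 \<le> V \<alpha>"
      using c f0[OF that] by (simp add: V_def)
    show "V \<alpha> \<le> 1"
    proof (cases "\<alpha> \<in> T")
      case False
      then show ?thesis
        using Vle[OF that] c by fastforce
    qed (simp add: V_def)
  qed
  have mono: "V \<alpha> \<le> V \<beta> \<longleftrightarrow> le \<alpha> \<beta>" if "\<alpha> \<in> L" "\<beta> \<in> L" for \<alpha> \<beta>
  proof (cases "\<beta> \<in> T")
    case True
    then show ?thesis
      using V01[OF that(1)] th theory_weaken by (auto simp: V_def[of \<beta>] le_def)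
  next
    case False
    show ?thesis
    proof (cases "\<alpha> \<in> T")
      case True
      then have "\<not> le \<alpha> \<beta>"
        using False th theory_MP by (auto simp: le_def)
      then show ?thesis
        using Vle[OF that(2) False] True c by (simp add: V_def[of \<alpha>])
    next
      case F: False
      then show ?thesis
        using False c fle[OF that] by (simp add: V_def)
    qed
  qed
  have eq: "V \<alpha> = V \<beta>" if "le \<alpha> \<beta>" "le \<beta> \<alpha>" "\<alpha> \<in> L" "\<beta> \<in> L" for \<alpha> \<beta>
    using that mono by (metis order_antisym)
  have con: "V (Con \<alpha> \<beta>) = min (V \<alpha>) (V \<beta>)" if "\<alpha> \<in> L" "\<beta> \<in> L" for \<alpha> \<beta>
  proof -
    have le12: "le (Con \<alpha> \<beta>) \<alpha>" "le (Con \<alpha> \<beta>) \<beta>"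
      using th theory_prv prv_Con1 prv_Con2 by (auto simp: le_def)
    have imp: "Imp \<alpha> (Imp \<beta> (Con \<alpha> \<beta>)) \<in> T"
      using th theory_prv prv_ConI by blast
    show ?thesis
    proof (cases "le \<alpha> \<beta>")
      case True
      then have "le \<alpha> (Con \<alpha> \<beta>)"
        using theory_distrib[OF th imp] by (simp add: le_def)
      then show ?thesis
        using eq[of "Con \<alpha> \<beta>" \<alpha>] le12 that closed(2) True mono by (simp add: min_def)
    next
      case False
      then have "le \<beta> \<alpha>"
        using total by blast
      then have "Imp \<beta> (Imp \<beta> (Con \<alpha> \<beta>)) \<in> T"
        using theory_trans[OF th _ imp] by (simp add: le_def)
      then have "le \<beta> (Con \<alpha> \<beta>)"
        using theory_distrib[OF th] refl[of \<beta>] unfolding le_def by blast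
      then show ?thesis
        using eq[of "Con \<alpha> \<beta>" \<beta>] le12 that closed(2) False mono by (simp add: min_def)
    qed
  qed
  have imp: "V (Imp \<alpha> \<beta>) = goedel_imp (V \<alpha>) (V \<beta>)" if "\<alpha> \<in> L" "\<beta> \<in> L" for \<alpha> \<beta>
  proof (cases "le \<alpha> \<beta>")
    case True
    then show ?thesis
      using mono that by (simp add: goedel_imp_def V_def[of "Imp \<alpha> \<beta>"] le_def)
  next
    case False
    then have "\<not> le \<alpha> (Imp \<alpha> \<beta>)"
      using theory_distrib[OF th] refl[of \<alpha>] unfolding le_def by blast
    then have "le (Imp \<alpha> \<beta>) \<alpha>"
      using total by blast
    then have "le (Imp \<alpha> \<beta>) \<beta>"
      using theory_distrib[OF th, of "Imp \<alpha> \<beta>" \<alpha> \<beta>] refl[of "Imp \<alpha> \<beta>"]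
      unfolding le_def by blast
    moreover have "le \<beta> (Imp \<alpha> \<beta>)"
      using th theory_prv prv_weakening by (auto simp: le_def)
    ultimately show ?thesis
      using eq[of "Imp \<alpha> \<beta>" \<beta>] mono that False closed(3) by (simp add: goedel_imp_def)
  qed
  have "le Bot \<alpha>" for \<alpha>
    using th theory_prv prv_ex_falso by (auto simp: le_def)
  then have bot: "V Bot = 0"
    using fbot Bot by (simp add: V_def)
  have "goedel_val L V"
    unfolding goedel_val_def using V01 bot con imp th theory_prv by (auto simp: V_def)
  then show ?thesis
    using that[of V] Vle by (simp add: V_def)
qed

end


section \<open>The canonical model\<close>

instance fm :: (countable, countable) countable
  by countable_datatype

definition lang :: "'p set \<Rightarrow> 'a set \<Rightarrow> ('p, 'a) fm set" where
  "lang P A = {\<phi>. set1_fm \<phi> \<subseteq> P \<and> set2_fm \<phi> \<subseteq> A}"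

lemma lang_simps [simp]:
  "Atom p \<in> lang P A \<longleftrightarrow> p \<in> P"
  "Bot \<in> lang P A"
  "Con \<phi> \<psi> \<in> lang P A \<longleftrightarrow> \<phi> \<in> lang P A \<and> \<psi> \<in> lang P A"
  "Imp \<phi> \<psi> \<in> lang P A \<longleftrightarrow> \<phi> \<in> lang P A \<and> \<psi> \<in> lang P A"
  "Bel a \<phi> \<in> lang P A \<longleftrightarrow> a \<in> A \<and> \<phi> \<in> lang P A"
  by (auto simp: lang_def)

lemma countable_lang:
  assumes "countable P" and "countable A"
  shows "countable (lang P A)"
proof -
  have "inj_on (map_fm (to_nat_on P) (to_nat_on A)) (lang P A)"
  proof (rule inj_onI)
    fix \<phi> \<psi> assume "\<phi> \<in> lang P A" "\<psi> \<in> lang P A"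
      and "map_fm (to_nat_on P) (to_nat_on A) \<phi> = map_fm (to_nat_on P) (to_nat_on A) \<psi>"
    then show "\<phi> = \<psi>"
      using assms unfolding lang_def
      by (elim fm.inj_map_strong[rotated 2]) (auto dest!: subsetD simp: to_nat_on_inj)
  qed
  then show ?thesis
    by (rule countableI')
qed

lemma countable_closure:
  assumes "countable I" and "x\<^sub>0 \<in> H" and step: "\<And>i x. i \<in> I \<Longrightarrow> x \<in> H \<Longrightarrow> \<exists>y\<in>H. R i x y"
  shows "\<exists>W. countable W \<and> x\<^sub>0 \<in> W \<and> W \<subseteq> H \<and> (\<forall>i\<in>I. \<forall>x\<in>W. \<exists>y\<in>W. R i x y)"
proof -
  obtain f where f: "\<And>i x. i \<in> I \<Longrightarrow> x \<in> H \<Longrightarrow> f i x \<in> H \<and> R i x (f i x)"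
    using step by metis
  define W where "W = (\<lambda>l. foldr f l x\<^sub>0) ` lists I"
  have H: "foldr f l x\<^sub>0 \<in> H" if "l \<in> lists I" for l
    using that by induction (use assms(2) f in auto)
  show ?thesis
  proof (intro exI[of _ W] conjI ballI)
    show "countable W"
      using assms(1) by (simp add: W_def)
    show "x\<^sub>0 \<in> W"
      unfolding W_def by (rule image_eqI[of _ _ "[]"]) auto
    show "W \<subseteq> H"
      using H by (auto simp: W_def)
    show "\<exists>y\<in>W. R i x y" if "i \<in> I" "x \<in> W" for i x
    proof -
      obtain l where l: "l \<in> lists I" "x = foldr f l x\<^sub>0"
        using \<open>x \<in> W\<close> by (auto simp: W_def)
      then have "f i x \<in> W"
        using \<open>i \<in> I\<close> unfolding W_def by (intro image_eqI[of _ _ "i # l"]) auto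
      then show ?thesis
        using f[OF \<open>i \<in> I\<close> H[OF l(1)]] l(2) by blast
    qed
  qed
qed

locale serial_transitive_logic = normal_logic Ax C
  for Ax :: "('p, 'a) fm set" and C :: "('p, 'a) model set" +
  fixes P :: "'p set" and A :: "'a set"
  assumes axD_subset: "axD \<subseteq> Ax" and ax4_subset: "ax4 \<subseteq> Ax"
    and countable_atoms: "countable P" and countable_agents: "countable A"
begin

abbreviation L :: "('p, 'a) fm set" where
  "L \<equiv> lang P A"

lemma val_range: "goedel_val L V \<Longrightarrow> \<phi> \<in> L \<Longrightarrow> 0 \<le> V \<phi> \<and> V \<phi> \<le> 1"
  by (simp add: goedel_val_def)

lemma val_mono:
  assumes "goedel_val L V" and "\<phi> \<in> L" and "\<psi> \<in> L" and "prv (Imp \<phi> \<psi>)"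
  shows "V \<phi> \<le> V \<psi>"
proof -
  have "goedel_imp (V \<phi>) (V \<psi>) = 1"
    using assms by (fastforce simp: goedel_val_def)
  then show ?thesis
    using goedel_imp_eq_1_iff val_range assms by blast
qed

lemma prv_Bel_mono: "prv (Imp \<phi> \<psi>) \<Longrightarrow> prv (Imp (Bel a \<phi>) (Bel a \<psi>))"
  using derivable_MP[OF prv_K prv_necessitation] .

lemma prv_Bel_Con: "prv (Imp (Bel a \<phi>) (Imp (Bel a \<psi>) (Bel a (Con \<phi> \<psi>))))"
  using theory_trans[OF theory_set_prv] prv_Bel_mono[OF prv_ConI] prv_K by blast

lemma val_Bel_Con:
  assumes V: "goedel_val L V" and "a \<in> A" "\<phi> \<in> L" "\<psi> \<in> L"
  shows "min (V (Bel a \<phi>)) (V (Bel a \<psi>)) \<le> V (Bel a (Con \<phi> \<psi>))"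
proof -
  have "V (Bel a \<phi>) \<le> V (Imp (Bel a \<psi>) (Bel a (Con \<phi> \<psi>)))"
    using assms by (intro val_mono[OF V]) (simp_all add: prv_Bel_Con)
  also have "\<dots> = goedel_imp (V (Bel a \<psi>)) (V (Bel a (Con \<phi> \<psi>)))"
    using assms by (simp add: goedel_val_def)
  finally show ?thesis
    using val_range[OF V, of "Bel a \<phi>"] assms by (simp add: le_goedel_imp_iff)
qed

text \<open>
  Giving the new world value 1, rather than just a value \<open>\<ge> V (Bel a \<psi>)\<close>, on every \<open>\<psi>\<close> with
  \<open>V (Bel a \<psi>) > c\<close> reduces the claim to the consistency of a set of formulas; values off
  the resulting prime theory can be made as small as desired.
\<close>

lemma witness:
  assumes V: "goedel_val L V" and a: "a \<in> A" and \<phi>: "\<phi> \<in> L"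
    and le: "V (Bel a \<phi>) \<le> c" and c: "c < 1" "0 < c \<or> \<phi> = Bot \<and> c = 0"
  obtains V' where "goedel_val L V'" "V' \<phi> \<le> c"
    "\<And>\<psi>. \<psi> \<in> L \<Longrightarrow> c < V (Bel a \<psi>) \<Longrightarrow> V' \<psi> = 1"
proof -
  note prv_trans = theory_trans[OF theory_set_prv, simplified]
  define T\<^sub>0 where "T\<^sub>0 = {\<chi>. \<exists>\<gamma>\<in>L. c < V (Bel a \<gamma>) \<and> prv (Imp \<gamma> \<chi>)}"
  have "theory_set T\<^sub>0"
    unfolding theory_set_def
  proof (intro conjI allI impI subsetI)
    fix \<chi> assume "\<chi> \<in> {\<chi>. prv \<chi>}"
    then have "prv (Imp (Imp Bot Bot) \<chi>)"
      using derivable_MP[OF prv_weakening] by simp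
    moreover have "V (Bel a (Imp Bot Bot)) = 1"
      using V a prv_necessitation[OF prv_refl] by (simp add: goedel_val_def)
    ultimately show "\<chi> \<in> T\<^sub>0"
      using c unfolding T\<^sub>0_def by (intro CollectI bexI[of _ "Imp Bot Bot"]) auto
  next
    fix \<chi> \<chi>' assume "Imp \<chi> \<chi>' \<in> T\<^sub>0" "\<chi> \<in> T\<^sub>0"
    then obtain \<gamma> \<gamma>' where \<gamma>: "\<gamma> \<in> L" "c < V (Bel a \<gamma>)" "prv (Imp \<gamma> (Imp \<chi> \<chi>'))"
      "\<gamma>' \<in> L" "c < V (Bel a \<gamma>')" "prv (Imp \<gamma>' \<chi>)"
      by (auto simp: T\<^sub>0_def)
    have "prv (Imp (Con \<gamma> \<gamma>') \<chi>')"
      using theory_distrib[OF theory_set_prv, simplified] prv_trans[OF prv_Con1 \<gamma>(3)]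
        prv_trans[OF prv_Con2 \<gamma>(6)] by blast
    moreover have "c < V (Bel a (Con \<gamma> \<gamma>'))"
      using val_Bel_Con[OF V a \<gamma>(1,4)] \<gamma>(2,5) by linarith
    ultimately show "\<chi>' \<in> T\<^sub>0"
      using \<gamma>(1,4) unfolding T\<^sub>0_def by (intro CollectI bexI[of _ "Con \<gamma> \<gamma>'"]) auto
  qed
  moreover have "\<phi> \<notin> T\<^sub>0"
  proof
    assume "\<phi> \<in> T\<^sub>0"
    then obtain \<gamma> where \<gamma>: "\<gamma> \<in> L" "c < V (Bel a \<gamma>)" "prv (Imp \<gamma> \<phi>)"
      by (auto simp: T\<^sub>0_def)
    then have "V (Bel a \<gamma>) \<le> V (Bel a \<phi>)"
      using a \<phi> by (intro val_mono[OF V] prv_Bel_mono) auto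
    then show False
      using \<gamma>(2) le by simp
  qed
  ultimately obtain T where T: "prime_theory T" "T\<^sub>0 \<subseteq> T" "\<phi> \<notin> T"
    by (rule prime_theory_extension)
  then have Bot: "Bot \<notin> T"
    using theory_MP theory_prv prv_ex_falso unfolding prime_theory_def by blast
  obtain V' where V': "goedel_val L V'" "\<And>\<chi>. \<chi> \<in> T \<Longrightarrow> V' \<chi> = 1"
      "\<And>\<chi>. \<chi> \<in> L \<Longrightarrow> \<chi> \<notin> T \<Longrightarrow> V' \<chi> \<le> (if c = 0 then 1 / 2 else c)"
    by (rule goedel_val_of_prime_theory[OF _ _ _ _ T(1) Bot, of L "if c = 0 then 1 / 2 else c"])
      (use c countable_lang[OF countable_atoms countable_agents] in auto)
  show ?thesis
  proof (rule that[OF V'(1)])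
    show "V' \<phi> \<le> c"
      using c(2) V'(1) V'(3)[OF \<phi> T(3)] by (auto simp: goedel_val_def)
    show "V' \<psi> = 1" if "\<psi> \<in> L" "c < V (Bel a \<psi>)" for \<psi>
      using that T(2) prv_refl by (intro V'(2)) (auto simp: T\<^sub>0_def)
  qed
qed

definition dissim :: "'a \<Rightarrow> (('p, 'a) fm \<Rightarrow> real) \<Rightarrow> (('p, 'a) fm \<Rightarrow> real) \<Rightarrow> real" where
  "dissim a V V' = Sup (insert 0 {V (Bel a \<psi>) | \<psi>. Bel a \<psi> \<in> L \<and> V' \<psi> < V (Bel a \<psi>)})"

lemma dissim_le_iff:
  assumes "goedel_val L V"
  shows "dissim a V V' \<le> c \<longleftrightarrow> 0 \<le> c \<and> (\<forall>\<psi>. Bel a \<psi> \<in> L \<longrightarrow> V (Bel a \<psi>) \<le> max c (V' \<psi>))"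
proof -
  have "bdd_above (insert 0 {V (Bel a \<psi>) | \<psi>. Bel a \<psi> \<in> L \<and> V' \<psi> < V (Bel a \<psi>)})"
    using val_range[OF assms] by (intro bdd_aboveI[of _ 1]) auto
  then have "dissim a V V' \<le> c \<longleftrightarrow>
      0 \<le> c \<and> (\<forall>\<psi>. Bel a \<psi> \<in> L \<longrightarrow> V' \<psi> < V (Bel a \<psi>) \<longrightarrow> V (Bel a \<psi>) \<le> c)"
    unfolding dissim_def by (subst cSup_le_iff) blast+
  then show ?thesis
    by (metis le_max_iff_disj not_less)
qed

lemma dissim_nonneg: "goedel_val L V \<Longrightarrow> 0 \<le> dissim a V V'"
  using dissim_le_iff[of V a V' "dissim a V V'"] by simp

lemma dissim_le_1: "goedel_val L V \<Longrightarrow> dissim a V V' \<le> 1"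
  using val_range[of V] by (auto simp: dissim_le_iff le_max_iff_disj simp del: lang_simps)

lemma val_Bel_le:
  assumes "goedel_val L V" and "Bel a \<psi> \<in> L"
  shows "V (Bel a \<psi>) \<le> max (dissim a V V') (V' \<psi>)"
  using dissim_le_iff[OF assms(1), of a V' "dissim a V V'"] assms(2) by blast

lemma dissim_triangle:
  assumes V: "goedel_val L V" and V': "goedel_val L V'"
  shows "dissim a V V'' \<le> max (dissim a V V') (dissim a V' V'')"
  unfolding dissim_le_iff[OF V]
proof (intro conjI allI impI)
  show "0 \<le> max (dissim a V V') (dissim a V' V'')"
    using dissim_nonneg[OF V, of a V'] by linarith
  fix \<psi> assume \<psi>: "Bel a \<psi> \<in> L"
  then have "V (Bel a \<psi>) \<le> V (Bel a (Bel a \<psi>))"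
    using ax4_subset by (intro val_mono[OF V] derivable_axiom) (auto simp: ax4_def)
  moreover have "V (Bel a (Bel a \<psi>)) \<le> max (dissim a V V') (V' (Bel a \<psi>))"
    using \<psi> by (intro val_Bel_le[OF V]) simp
  moreover have "V' (Bel a \<psi>) \<le> max (dissim a V' V'') (V'' \<psi>)"
    using \<psi> by (intro val_Bel_le[OF V'])
  ultimately show "V (Bel a \<psi>) \<le> max (max (dissim a V V') (dissim a V' V'')) (V'' \<psi>)"
    by linarith
qed

text \<open>
  The reals \<open>c\<close> are restricted to rationals to keep the set of worlds countable; \<open>c = 0\<close> with
  \<open>\<phi> = Bot\<close> yields seriality.
\<close>

lemma countable_worlds:
  assumes "goedel_val L V\<^sub>0"
  shows "\<exists>W. countable W \<and> V\<^sub>0 \<in> W \<and> (\<forall>V\<in>W. goedel_val L V) \<and>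
    (\<forall>V\<in>W. \<forall>a\<in>A. \<forall>\<phi>\<in>L. \<forall>c\<in>\<rat>. V (Bel a \<phi>) \<le> c \<and> c < 1 \<and> (0 < c \<or> \<phi> = Bot \<and> c = 0) \<longrightarrow>
      (\<exists>V'\<in>W. V' \<phi> \<le> c \<and> dissim a V V' \<le> c))"
proof -
  define R where "R = (\<lambda>(a, \<phi>, c) V V'. V (Bel a \<phi>) \<le> c \<and> c < 1 \<and> (0 < c \<or> \<phi> = Bot \<and> c = 0) \<longrightarrow>
    V' \<phi> \<le> c \<and> dissim a V V' \<le> (c :: real))"
  have "countable (A \<times> L \<times> (\<rat> :: real set))"
    using countable_lang[OF countable_atoms countable_agents] countable_agents countable_rat
    by (intro countable_SIGMA)
  moreover have "V\<^sub>0 \<in> {V. goedel_val L V}"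
    using assms by simp
  moreover have "\<exists>V'\<in>{V. goedel_val L V}. R i V V'"
    if i: "i \<in> A \<times> L \<times> \<rat>" and V: "V \<in> {V. goedel_val L V}" for i V
  proof -
    obtain a \<phi> c where [simp]: "i = (a, \<phi>, c)" and a: "a \<in> A" and \<phi>: "\<phi> \<in> L"
      using i by auto
    show ?thesis
    proof (cases "V (Bel a \<phi>) \<le> c \<and> c < 1 \<and> (0 < c \<or> \<phi> = Bot \<and> c = 0)")
      case True
      then obtain V' where V': "goedel_val L V'" "V' \<phi> \<le> c"
        "\<And>\<psi>. \<psi> \<in> L \<Longrightarrow> c < V (Bel a \<psi>) \<Longrightarrow> V' \<psi> = 1"
        using witness[of V a \<phi> c] V a \<phi> by auto
      have "V (Bel a \<psi>) \<le> max c (V' \<psi>)" if "\<psi> \<in> L" for \<psi>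
        using V'(3)[OF that] val_range[of V "Bel a \<psi>"] V a that by fastforce
      then have "dissim a V V' \<le> c"
        using V True by (auto simp: dissim_le_iff)
      then show ?thesis
        using V' by (auto simp: R_def)
    next
      case False
      then show ?thesis
        using V by (intro bexI[of _ V]) (auto simp: R_def)
    qed
  qed
  ultimately have "\<exists>W. countable W \<and> V\<^sub>0 \<in> W \<and> W \<subseteq> {V. goedel_val L V} \<and>
      (\<forall>i\<in>A \<times> L \<times> \<rat>. \<forall>V\<in>W. \<exists>V'\<in>W. R i V V')"
    by (rule countable_closure)
  then obtain W where W: "countable W" "V\<^sub>0 \<in> W" "W \<subseteq> {V. goedel_val L V}"
    and step: "\<forall>i\<in>A \<times> L \<times> \<rat>. \<forall>V\<in>W. \<exists>V'\<in>W. R i V V'"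
    by blast
  show ?thesis
  proof (intro exI[of _ W] conjI ballI impI)
    show "goedel_val L V" if "V \<in> W" for V
      using that W(3) by blast
    show "\<exists>V'\<in>W. V' \<phi> \<le> c \<and> dissim a V V' \<le> c"
      if "V \<in> W" "a \<in> A" "\<phi> \<in> L" "c \<in> \<rat>" "V (Bel a \<phi>) \<le> c \<and> c < 1 \<and> (0 < c \<or> \<phi> = Bot \<and> c = 0)"
      for V a \<phi> c
      using step[rule_format, of "(a, \<phi>, c)" V] that by (simp add: R_def)
  qed (rule W)+
qed

definition canonical_model ::
  "(('p, 'a) fm \<Rightarrow> real) set \<Rightarrow> (('p, 'a) fm \<Rightarrow> real, 'p, 'a) egl" where
  "canonical_model W = \<lparr>worlds = W, acc = (\<lambda>a V V'. 1 - dissim a V V'),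
     val = (\<lambda>V p. if p \<in> P then V (Atom p) else 0)\<rparr>"

lemma countermodel:
  assumes "\<phi> \<in> L" and "\<not> prv \<phi>"
  obtains M :: "(('p, 'a) fm \<Rightarrow> real, 'p, 'a) egl"
  where "egl_model M" "serial M" "transitive M" "axT \<subseteq> Ax \<Longrightarrow> reflexive M" "\<not> true_in M \<phi>"
proof -
  obtain T where T: "prime_theory T" "{\<chi>. prv \<chi>} \<subseteq> T" "\<phi> \<notin> T"
    using prime_theory_extension[OF theory_set_prv] assms(2) by blast
  then have Bot: "Bot \<notin> T"
    using theory_MP theory_prv prv_ex_falso unfolding prime_theory_def by blast
  obtain V\<^sub>0 where V\<^sub>0: "goedel_val L V\<^sub>0" "V\<^sub>0 \<phi> \<le> 1 / 2"
    by (rule goedel_val_of_prime_theory[OF _ _ _ _ T(1) Bot, of L "1 / 2"])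
      (use T(3) assms(1) countable_lang[OF countable_atoms countable_agents] in auto)
  obtain W where W: "countable W" "V\<^sub>0 \<in> W" and val: "\<And>V. V \<in> W \<Longrightarrow> goedel_val L V"
    and wit: "\<forall>V\<in>W. \<forall>a\<in>A. \<forall>\<phi>\<in>L. \<forall>c\<in>\<rat>.
      V (Bel a \<phi>) \<le> c \<and> c < 1 \<and> (0 < c \<or> \<phi> = Bot \<and> c = 0) \<longrightarrow>
      (\<exists>V'\<in>W. V' \<phi> \<le> c \<and> dissim a V V' \<le> c)"
    using countable_worlds[OF V\<^sub>0(1)] by blast
  define M where "M = canonical_model W"
  have M_simps [simp]: "worlds M = W" "acc M a V V' = 1 - dissim a V V'"
    "val M V p = (if p \<in> P then V (Atom p) else 0)" for a V V' p
    by (simp_all add: M_def canonical_model_def)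
  have model: "egl_model M"
    using W val val_range dissim_nonneg dissim_le_1 by (auto simp: egl_model_def)
  have trans: "transitive M"
    unfolding transitive_def
  proof (intro allI ballI)
    fix a V V' V'' assume "V \<in> worlds M" "V' \<in> worlds M"
    then show "min (acc M a V V') (acc M a V' V'') \<le> acc M a V V''"
      using dissim_triangle[of V V' a V''] val by simp
  qed
  have refl: "reflexive M" if "axT \<subseteq> Ax"
    unfolding reflexive_def
  proof (intro allI ballI)
    fix a V assume "V \<in> worlds M"
    then have V: "goedel_val L V"
      using val by simp
    have "V (Bel a \<psi>) \<le> max 0 (V \<psi>)" if "Bel a \<psi> \<in> L" for \<psi>
    proof -
      have "V (Bel a \<psi>) \<le> V \<psi>"
        using that \<open>axT \<subseteq> Ax\<close> by (intro val_mono[OF V] derivable_axiom) (auto simp: axT_def)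
      then show ?thesis by simp
    qed
    then have "dissim a V V \<le> 0"
      using dissim_le_iff[OF V] by blast
    then show "acc M a V V = 1"
      using dissim_nonneg[OF V, of a V] by simp
  qed
  have ser: "serial M"
    unfolding serial_def
  proof (intro allI ballI)
    fix a V assume "V \<in> worlds M"
    then have V: "V \<in> W" "goedel_val L V"
      using val by simp_all
    have "\<exists>V'\<in>W. dissim a V V' \<le> 0"
    proof (cases "a \<in> A")
      case True
      have "V (Bel a Bot) \<le> V Bot"
        using True axD_subset by (intro val_mono[OF V(2)] derivable_axiom) (auto simp: axD_def)
      then have "V (Bel a Bot) \<le> 0"
        using V(2) by (simp add: goedel_val_def)
      then show ?thesis
        using wit[rule_format, OF V(1) True, of Bot 0] by auto
    next
      case False
      then show ?thesis
        using V by (auto simp: dissim_le_iff)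
    qed
    then obtain V' where "V' \<in> W" "dissim a V V' \<le> 0"
      by blast
    then show "\<exists>V'\<in>worlds M. acc M a V V' = 1"
      using dissim_nonneg[OF V(2), of a V'] by (intro bexI[of _ V']) auto
  qed
  have truth: "eval_fm M \<psi> V = V \<psi>" if "\<psi> \<in> L" "V \<in> W" for \<psi> V
    using that
  proof (induction \<psi> arbitrary: V)
    case (Bel a \<psi>)
    then have a: "a \<in> A" and \<psi>: "\<psi> \<in> L" and V: "goedel_val L V"
      using val by auto
    have le: "eval_fm M (Bel a \<psi>) V \<le> max (dissim a V V') (V' \<psi>)" if "V' \<in> W" for V'
      using eval_Bel_le[OF model, of V' a \<psi> V] Bel.IH[OF \<psi> that] that
      by (simp del: eval_fm.simps)
    have "V (Bel a \<psi>) \<le> eval_fm M (Bel a \<psi>) V"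
    proof (rule le_eval_Bel)
      show "V (Bel a \<psi>) \<le> max (1 - acc M a V V') (eval_fm M \<psi> V')" if "V' \<in> worlds M" for V'
        using that Bel.IH[OF \<psi>] val_Bel_le[OF V Bel.prems(1), of V'] by simp
    qed (use W in auto)
    moreover have "eval_fm M (Bel a \<psi>) V \<le> V (Bel a \<psi>)"
    proof (rule ccontr)
      assume "\<not> ?thesis"
      then obtain c where c: "c \<in> \<rat>" "V (Bel a \<psi>) < c" "c < eval_fm M (Bel a \<psi>) V"
        using Rats_dense_in_real by (metis not_le)
      moreover have "0 < c" "c < 1"
        using c val_range[OF V Bel.prems(1)] eval_fm_range[OF model, of V "Bel a \<psi>"] Bel.prems(2)
        by (simp_all del: eval_fm.simps)
      ultimately obtain V' where "V' \<in> W" "V' \<psi> \<le> c" "dissim a V V' \<le> c"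
        using wit[rule_format, OF Bel.prems(2) a \<psi>, of c] by auto
      then show False
        using le[of V'] c(3) by linarith
    qed
    ultimately show ?case
      by linarith
  next
    case (Atom p)
    then show ?case by simp
  next
    case Bot
    then show ?case using val by (simp add: goedel_val_def)
  next
    case (Con \<psi> \<chi>)
    then show ?case using val[of V] by (simp add: goedel_val_def)
  next
    case (Imp \<psi> \<chi>)
    then show ?case using val[of V] by (simp add: goedel_val_def)
  qed
  have "\<not> true_in M \<phi>"
    using truth[OF assms(1) W(2)] V\<^sub>0(2) W(2) by (force simp: true_in_def)
  then show ?thesis
    using that model ser trans refl by blast
qed

end

lemma BF_axioms_valid: "\<phi> \<in> BF_axioms \<Longrightarrow> valid_in serial_transitive \<phi>"
  by (auto simp: valid_in_def serial_transitive_def BF_axioms_def KF_axioms_def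
      intro: axA_true_in axK_true_in axD_true_in ax4_true_in)

lemma TF_axioms_valid: "\<phi> \<in> TF_axioms \<Longrightarrow> valid_in serial_transitive_reflexive \<phi>"
  by (auto simp: valid_in_def serial_transitive_reflexive_def TF_axioms_def BF_axioms_def
      KF_axioms_def intro: axA_true_in axK_true_in axD_true_in ax4_true_in axT_true_in)

lemma finite_symbols:
  "finite (set1_fm \<phi>)" "finite (set2_fm \<phi>)"
  by (induction \<phi>) auto

lemma normal_logic_BF: "normal_logic BF_axioms serial_transitive"
  by unfold_locales (use BF_axioms_valid in \<open>auto simp: BF_axioms_def serial_transitive_def\<close>)

lemma normal_logic_TF: "normal_logic TF_axioms serial_transitive_reflexive"
  by unfold_locales (use TF_axioms_valid in
    \<open>auto simp: TF_axioms_def BF_axioms_def serial_transitive_reflexive_def\<close>)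

lemma BF_complete:
  assumes "valid_in serial_transitive \<phi>"
  shows "derivable_BF \<phi>"
proof -
  interpret normal_logic BF_axioms serial_transitive
    by (rule normal_logic_BF)
  interpret serial_transitive_logic BF_axioms serial_transitive "set1_fm \<phi>" "set2_fm \<phi>"
    by unfold_locales (auto simp: BF_axioms_def finite_symbols countable_finite)
  show ?thesis
    unfolding derivable_BF_def
    using countermodel[of \<phi>] valid_in_imp_true_in(1)[OF _ _ _ assms] by (auto simp: lang_def)
qed

lemma TF_complete:
  assumes "valid_in serial_transitive_reflexive \<phi>"
  shows "derivable_TF \<phi>"
proof -
  interpret normal_logic TF_axioms serial_transitive_reflexive
    by (rule normal_logic_TF)
  interpret serial_transitive_logic TF_axioms serial_transitive_reflexive "set1_fm \<phi>" "set2_fm \<phi>"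
    by unfold_locales (auto simp: TF_axioms_def BF_axioms_def finite_symbols countable_finite)
  have "axT \<subseteq> TF_axioms"
    by (simp add: TF_axioms_def)
  then show ?thesis
    unfolding derivable_TF_def
    using countermodel[of \<phi>] valid_in_imp_true_in(2)[OF _ _ _ assms] by (auto simp: lang_def)
qed

theorem corollary3p1:
  shows "semi_complete (derivable_BF :: ('p, 'a) fm \<Rightarrow> bool) serial_transitive \<and>
         semi_complete (derivable_TF :: ('p, 'a) fm \<Rightarrow> bool) serial_transitive_reflexive"
proof -
  have "derivable_BF (Neg (Neg \<phi>))" if "valid_in serial_transitive \<phi>" for \<phi> :: "('p, 'a) fm"
    using derivable_MP[OF normal_logic.prv_not_not[OF normal_logic_BF]] BF_complete[OF that]
    by (simp add: derivable_BF_def)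
  moreover have "derivable_TF (Neg (Neg \<phi>))" if "valid_in serial_transitive_reflexive \<phi>"
    for \<phi> :: "('p, 'a) fm"
    using derivable_MP[OF normal_logic.prv_not_not[OF normal_logic_TF]] TF_complete[OF that]
    by (simp add: derivable_TF_def)
  ultimately show ?thesis
    by (simp add: semi_complete_def)
qed

end
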